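(* Let $\mathcal{A}\in\mathbb{C}^{n\times n\times p}$ be a complex tensor and let $P_T(x)$ be the T-characteristic polynomial of $\mathcal{A}$. Then $\mathcal{A}$ satisfies its T-characteristic polynomial, i.e. $$P_T(\mathcal{A})=\mathcal{O},$$ where $\mathcal{O}$ is the zero tensor.
   Context: For $\mathcal{A}\in\mathbb{C}^{m\times n\times p}$ let $A^{(1)},\dots,A^{(p)}\in\mathbb{C}^{m\times n}$ be its frontal slices. $\mathrm{bcirc}(\mathcal{A})$ is the $mp\times np$ block circulant matrix whose $(i,j)$ block ($1\le i,j\le p$) is $A^{(((i-j)\bmod p)+1)}$; $\mathrm{unfold}(\mathcal{A})$ is the $mp\times n$ matrix obtained by stacking $A^{(1)},\dots,A^{(p)}$ vertically, and $\mathrm{fold}$ is the inverse of $\mathrm{unfold}$. The T-product is $\mathcal{A}*\mathcal{B}=\mathrm{fold}(\mathrm{bcirc}(\mathcal{A})\,\mathrm{unfold}(\mathcal{B}))$. Powers $\mathcal{A}^k$ are with respect to $*$, with $\mathcal{A}^0=\mathcal{I}$ the identity tensor (first frontal slice $I_n$, other slices zero); for a polynomial $q(x)=\sum_k c_kx^k$, $q(\mathcal{A})=\sum_k c_k\mathcal{A}^k$. Let $F_p$ be the unitary $p\times p$ discrete Fourier matrix with entries $\frac{1}{\sqrt p}\omega^{(j-1)(k-1)}$, $\omega=e^{-2\pi\mathbf{i}/p}$. For $\mathcal{A}\in\mathbb{C}^{n\times n\times p}$ one has the Fourier block diagonalization $\mathrm{bcirc}(\mathcal{A})=(F_p^H\otimes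 I_n)\,\mathrm{diag}(D_1,\dots,D_p)\,(F_p\otimes I_n)$ with $D_i\in\mathbb{C}^{n\times n}$. The T-characteristic polynomial of $\mathcal{A}$ is $P_T(x)=\mathrm{LCM}(P_{D_1}(x),\dots,P_{D_p}(x))$, the least common multiple of the characteristic polynomials $P_{D_i}(x)$ of the matrices $D_i$. *)

theory Defs
  imports
    "HOL-Computational_Algebra.Computational_Algebra"
    "HOL-Computational_Algebra.Field_as_Ring"
    "Jordan_Normal_Form.Matrix"
    "Jordan_Normal_Form.Char_Poly"
    "Jordan_Normal_Form.Schur_Decomposition"
begin

text \<open>
  A complex \<open>m \<times> n \<times> p\<close> tensor is represented by the list of its \<open>p\<close> frontal slices.
  All indices start at \<open>0\<close>, so the first frontal slice is \<open>A ! 0\<close> and the block of \<open>bcirc A\<close> at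
  position \<open>(a, b)\<close> is \<open>A ! ((a - b) mod p)\<close>.
\<close>

type_synonym tensor = "complex mat list"

definition carrier_tensor :: "nat \<Rightarrow> nat \<Rightarrow> nat \<Rightarrow> tensor set" where
  "carrier_tensor m n p = {A. length A = p \<and> set A \<subseteq> carrier_mat m n}"

definition slice_rows :: "tensor \<Rightarrow> nat" where
  "slice_rows A = dim_row (hd A)"

definition slice_cols :: "tensor \<Rightarrow> nat" where
  "slice_cols A = dim_col (hd A)"

text \<open>
  Row \<open>i\<close> of \<open>bcirc A\<close> lies in block row \<open>i div m\<close>, column \<open>j\<close> in block column \<open>j div n\<close>. The index
  of the block is computed on integers because subtraction on natural numbers truncates.
\<close>

definition bcirc :: "tensor \<Rightarrow> complex mat" where
  "bcirc A = (let m = slice_rows A; n = slice_cols A; p = length A in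
     mat (m * p) (n * p)
       (\<lambda>(i, j). (A ! nat ((int (i div m) - int (j div n)) mod int p)) $$ (i mod m, j mod n)))"

definition unfold_tensor :: "tensor \<Rightarrow> complex mat" where
  "unfold_tensor A = (let m = slice_rows A; n = slice_cols A; p = length A in
     mat (m * p) n (\<lambda>(i, j). (A ! (i div m)) $$ (i mod m, j)))"

definition fold_tensor :: "nat \<Rightarrow> complex mat \<Rightarrow> tensor" where
  "fold_tensor p M = (let m = dim_row M div p in
     map (\<lambda>k. mat m (dim_col M) (\<lambda>(i, j). M $$ (k * m + i, j))) [0..<p])"

definition t_prod :: "tensor \<Rightarrow> tensor \<Rightarrow> tensor" where
  "t_prod A B = fold_tensor (length A) (bcirc A * unfold_tensor B)"

definition zero_tensor :: "nat \<Rightarrow> nat \<Rightarrow> nat \<Rightarrow> tensor" where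
  "zero_tensor m n p = replicate p (0\<^sub>m m n)"

definition id_tensor :: "nat \<Rightarrow> nat \<Rightarrow> tensor" where
  "id_tensor n p = map (\<lambda>k. if k = 0 then 1\<^sub>m n else 0\<^sub>m n n) [0..<p]"

definition add_tensor :: "tensor \<Rightarrow> tensor \<Rightarrow> tensor" where
  "add_tensor A B = map2 (+) A B"

definition smult_tensor :: "complex \<Rightarrow> tensor \<Rightarrow> tensor" where
  "smult_tensor c A = map (\<lambda>X. c \<cdot>\<^sub>m X) A"

fun t_pow :: "tensor \<Rightarrow> nat \<Rightarrow> tensor" where
  "t_pow A 0 = id_tensor (slice_rows A) (length A)"
| "t_pow A (Suc k) = t_prod (t_pow A k) A"

definition t_poly :: "complex poly \<Rightarrow> tensor \<Rightarrow> tensor" where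
  "t_poly q A =
     foldr add_tensor (map (\<lambda>k. smult_tensor (coeff q k) (t_pow A k)) [0..<Suc (degree q)])
       (zero_tensor (slice_rows A) (slice_cols A) (length A))"

definition kronecker :: "complex mat \<Rightarrow> complex mat \<Rightarrow> complex mat" where
  "kronecker A B = mat (dim_row A * dim_row B) (dim_col A * dim_col B)
     (\<lambda>(i, j). A $$ (i div dim_row B, j div dim_col B) * B $$ (i mod dim_row B, j mod dim_col B))"

definition fourier_mat :: "nat \<Rightarrow> complex mat" where
  "fourier_mat p = mat p p
     (\<lambda>(j, k). 1 / complex_of_real (sqrt (real p)) *
               exp (- (2 * complex_of_real pi * \<i>) / of_nat p) ^ (j * k))"

definition is_fourier_blocks :: "nat \<Rightarrow> nat \<Rightarrow> tensor \<Rightarrow> complex mat list \<Rightarrow> bool" where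
  "is_fourier_blocks n p A Ds \<longleftrightarrow>
     length Ds = p \<and> set Ds \<subseteq> carrier_mat n n \<and>
     bcirc A = kronecker (mat_adjoint (fourier_mat p)) (1\<^sub>m n) * diag_block_mat Ds *
               kronecker (fourier_mat p) (1\<^sub>m n)"

text \<open>
  The blocks exist and are unique for every tensor in \<open>carrier_tensor n n p\<close> with positive \<open>n\<close>
  and \<open>p\<close>; see \<open>ex1_fourier_blocks\<close> below.
\<close>

definition fourier_blocks :: "tensor \<Rightarrow> complex mat list" where
  "fourier_blocks A = (THE Ds. is_fourier_blocks (slice_rows A) (length A) A Ds)"

text \<open>\<^const>\<open>Lcm\<close> on polynomials over a field is normalised to be monic.\<close>

definition t_char_poly :: "tensor \<Rightarrow> complex poly" where
  "t_char_poly A = Lcm (char_poly ` set (fourier_blocks A))"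


subsection \<open>Well-definedness\<close>

lemma carrier_tensorD:
  assumes "A \<in> carrier_tensor m n p"
  shows "length A = p" "k < p \<Longrightarrow> A ! k \<in> carrier_mat m n"
    "0 < p \<Longrightarrow> slice_rows A = m" "0 < p \<Longrightarrow> slice_cols A = n"
proof -
  show l: "length A = p" and k: "k < p \<Longrightarrow> A ! k \<in> carrier_mat m n" for k
    using assms by (auto simp: carrier_tensor_def)
  show "slice_rows A = m" "slice_cols A = n" if "0 < p"
    using k[OF that] l that by (cases A; auto simp: slice_rows_def slice_cols_def)+
qed

lemma block_index_less: "a < p \<Longrightarrow> r < n \<Longrightarrow> a * n + r < p * (n :: nat)"
proof -
  assume "a < p" "r < n"
  then have "a * n + r < Suc a * n" by simp
  also have "\<dots> \<le> p * n" using \<open>a < p\<close> by (intro mult_le_mono1) auto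
  finally show ?thesis .
qed

lemma sum_blocks:
  fixes f :: "nat \<Rightarrow> 'a :: comm_monoid_add"
  shows "sum f {0..<p * n} = (\<Sum>a<p. \<Sum>r<n. f (a * n + r))"
proof -
  have "sum f {m * n..<m * n + n} = (\<Sum>r<n. f (m * n + r))" for m
    using sum.shift_bounds_nat_ivl[of f 0 "m * n" n]
    by (simp add: atLeast0LessThan add.commute)
  then show ?thesis
    using sum.nat_group[of f n p] by (simp add: atLeast0LessThan)
qed

lemma eq_matI_blocks:
  assumes "A \<in> carrier_mat (p * n) (p * n)" "B \<in> carrier_mat (p * n) (p * n)" "0 < n"
    and "\<And>a b r s. a < p \<Longrightarrow> b < p \<Longrightarrow> r < n \<Longrightarrow> s < n \<Longrightarrow>
           A $$ (a * n + r, b * n + s) = B $$ (a * n + r, b * n + s)"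
  shows "A = B"
proof (rule eq_matI)
  fix i j assume "i < dim_row B" "j < dim_col B"
  then have "i div n < p" "j div n < p" "i mod n < n" "j mod n < n"
    using assms(1-3) by (auto simp: less_mult_imp_div_less)
  from assms(4)[OF this] show "A $$ (i, j) = B $$ (i, j)" by simp
qed (use assms in auto)

lemma fold_unfold_tensor:
  assumes "A \<in> carrier_tensor m n p" "0 < m" "0 < p"
  shows "fold_tensor p (unfold_tensor A) = A"
proof (rule nth_equalityI)
  show "length (fold_tensor p (unfold_tensor A)) = length A"
    using carrier_tensorD(1)[OF assms(1)] by (simp add: fold_tensor_def Let_def)
  fix k assume "k < length (fold_tensor p (unfold_tensor A))"
  then have k: "k < p" by (simp add: fold_tensor_def Let_def)
  have "k * m + i < m * p" if "i < m" for i
    using block_index_less[OF k that] by (simp add: mult.commute)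
  moreover have "A ! k \<in> carrier_mat m n" "length A = p" "slice_rows A = m" "slice_cols A = n"
    using carrier_tensorD[OF assms(1)] assms(3) k by blast+
  ultimately show "fold_tensor p (unfold_tensor A) ! k = A ! k"
    using assms(2,3) k by (auto simp: fold_tensor_def unfold_tensor_def Let_def intro!: eq_matI)
qed

lemma diag_block_carrier:
  assumes "set Ds \<subseteq> carrier_mat n n"
  shows "diag_block_mat Ds \<in> carrier_mat (length Ds * n) (length Ds * n)"
  using assms by (induction Ds) (auto simp: Let_def)

lemma diag_block_index:
  assumes "set Ds \<subseteq> carrier_mat n n" "a < length Ds" "b < length Ds" "r < n" "s < n"
  shows "diag_block_mat Ds $$ (a * n + r, b * n + s) = (if a = b then (Ds ! a) $$ (r, s) else 0)"
  using assms
proof (induction Ds arbitrary: a b)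
  case (Cons D Ds)
  have D: "D \<in> carrier_mat n n" and Ds: "set Ds \<subseteq> carrier_mat n n"
    using Cons.prems by auto
  have dim: "dim_row (diag_block_mat Ds) = length Ds * n" "dim_col (diag_block_mat Ds) = length Ds * n"
    using diag_block_carrier[OF Ds] by auto
  have i: "a * n + r < n + length Ds * n" "b * n + s < n + length Ds * n"
    using block_index_less[of a "Suc (length Ds)" r n] block_index_less[of b "Suc (length Ds)" s n]
      Cons.prems by auto
  show ?case
  proof (cases a)
    case a: 0
    show ?thesis
    proof (cases b)
      case 0
      then show ?thesis using a i D dim Cons.prems by (simp add: Let_def)
    next
      case (Suc b')
      have "b' * n + s < length Ds * n"
        using block_index_less[of b' "length Ds" s n] Cons.prems Suc by auto
      then show ?thesis using a i D dim Cons.prems Suc by (auto simp: Let_def)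
    qed
  next
    case a: (Suc a')
    have a': "a' * n + r < length Ds * n"
      using block_index_less[of a' "length Ds" r n] Cons.prems a by auto
    show ?thesis
    proof (cases b)
      case 0
      then show ?thesis using a a' i D dim Cons.prems by (auto simp: Let_def)
    next
      case (Suc b')
      then show ?thesis
        using a i D dim Cons.prems Cons.IH[OF Ds, of a' b'] by (auto simp: Let_def)
    qed
  qed
qed simp

definition dft_root :: "nat \<Rightarrow> complex" where
  "dft_root p = exp (- (2 * complex_of_real pi * \<i>) / of_nat p)"

lemma dft_root_cis: "dft_root p = cnj (cis (2 * pi / real p))"
  unfolding dft_root_def cis_cnj unfolding cis_conv_exp by (rule arg_cong[where f = exp]) (simp add: field_simps)

lemma dft_root_cnj: "dft_root p * cnj (dft_root p) = 1"
  by (simp add: dft_root_cis cis_cnj cis_mult)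

lemma dft_root_power: "0 < p \<Longrightarrow> dft_root p ^ p = 1"
  by (simp add: dft_root_cis DeMoivre flip: complex_cnj_power)

lemma dft_root_eq_1:
  assumes "dft_root p ^ k = 1" "k < p"
  shows "k = 0"
proof -
  have "cnj (cis (2 * pi / real p)) ^ k = 1" using assms(1) by (simp add: dft_root_cis)
  then have "cis (2 * pi / real p) ^ k = 1"
    by (metis complex_cnj_one complex_cnj_power complex_cnj_cnj)
  then have "cis (2 * pi * real k / real p) = cis (2 * pi * real 0 / real p)"
    by (simp add: DeMoivre mult_ac)
  moreover have "inj_on (\<lambda>k. cis (2 * pi * real k / real p)) {..<p}"
    using bij_betw_roots_unity[of p] assms(2) by (auto simp: bij_betw_def)
  ultimately show ?thesis using assms(2) by (auto dest: inj_onD[of _ _ k 0])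
qed

lemma dft_root_mod:
  assumes "0 < p"
  shows "dft_root p ^ (k mod p) = dft_root p ^ k"
proof -
  have "dft_root p ^ k = dft_root p ^ (p * (k div p) + k mod p)" by simp
  also have "\<dots> = dft_root p ^ (k mod p)"
    unfolding power_add power_mult dft_root_power[OF assms] by simp
  finally show ?thesis by simp
qed

lemma cnj_dft_root_power:
  assumes "a \<le> p" "0 < p"
  shows "cnj (dft_root p) ^ a = dft_root p ^ (p - a)"
proof -
  have "dft_root p ^ (p - a) * dft_root p ^ a = 1"
    using assms dft_root_power[of p] by (simp flip: power_add)
  moreover have "dft_root p ^ a * cnj (dft_root p) ^ a = 1"
    by (simp add: dft_root_cnj flip: power_mult_distrib)
  ultimately show ?thesis by (metis mult.assoc mult.left_neutral mult.right_neutral)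
qed

lemma dft_root_sum:
  assumes "0 < p"
  shows "(\<Sum>c<p. dft_root p ^ (c * k)) = (if p dvd k then of_nat p else 0)"
proof -
  let ?z = "dft_root p ^ k"
  have *: "(\<Sum>c<p. dft_root p ^ (c * k)) = (\<Sum>c<p. ?z ^ c)"
    by (simp add: mult.commute flip: power_mult)
  have zp: "?z ^ p = 1"
    using dft_root_power[OF assms] by (metis mult.commute power_mult power_one)
  show ?thesis
  proof (cases "p dvd k")
    case True
    then have "?z = 1"
      using dft_root_mod[OF assms, of k] by (simp add: dvd_eq_mod_eq_0)
    then show ?thesis unfolding * using True by simp
  next
    case False
    have "?z \<noteq> 1"
    proof
      assume "?z = 1"
      then have "dft_root p ^ (k mod p) = 1" by (simp only: dft_root_mod[OF assms])
      from dft_root_eq_1[OF this] show False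
        using False assms by (simp add: dvd_eq_mod_eq_0)
    qed
    from geometric_sum[OF this, of p] show ?thesis
      unfolding * zp using False by simp
  qed
qed

lemma fourier_mat_index:
  "j < p \<Longrightarrow> k < p \<Longrightarrow> fourier_mat p $$ (j, k) = 1 / complex_of_real (sqrt (real p)) * dft_root p ^ (j * k)"
  by (simp add: fourier_mat_def dft_root_def)

lemma fourier_mat_carrier: "fourier_mat p \<in> carrier_mat p p"
  by (simp add: fourier_mat_def)

lemma adjoint_carrier: "mat_adjoint (fourier_mat p) \<in> carrier_mat p p"
  unfolding mat_adjoint_def carrier_mat_def by (simp add: fourier_mat_def)

lemma adjoint_index:
  assumes "j < p" "k < p"
  shows "mat_adjoint (fourier_mat p) $$ (j, k) = cnj (fourier_mat p $$ (k, j))"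
  using assms fourier_mat_carrier[of p]
  by (auto simp: mat_adjoint_def mat_of_rows_def conjugate_complex_def)

lemma kronecker_one_index:
  assumes "M \<in> carrier_mat p p" "a < p" "b < p" "r < n" "s < n"
  shows "kronecker M (1\<^sub>m n) $$ (a * n + r, b * n + s) = (if r = s then M $$ (a, b) else 0)"
  using assms block_index_less[of a p r n] block_index_less[of b p s n]
  by (auto simp: kronecker_def)

lemma kronecker_one_carrier:
  "M \<in> carrier_mat p p \<Longrightarrow> kronecker M (1\<^sub>m n) \<in> carrier_mat (p * n) (p * n)"
  by (auto simp: kronecker_def)

lemma mult_index_blocks:
  assumes "A \<in> carrier_mat (p * n) (p * n)" "B \<in> carrier_mat (p * n) (p * n)"
    "i < p * n" "j < p * n"
  shows "(A * B) $$ (i, j) = (\<Sum>c<p. \<Sum>t<n. A $$ (i, c * n + t) * B $$ (c * n + t, j))"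
proof -
  have "(A * B) $$ (i, j) = (\<Sum>k\<in>{0..<p * n}. A $$ (i, k) * B $$ (k, j))"
    using assms by (auto simp: scalar_prod_def intro!: sum.cong)
  then show ?thesis by (simp add: sum_blocks)
qed

lemma fourier_product_index:
  assumes Ds: "length Ds = p" "set Ds \<subseteq> carrier_mat n n"
    and abrs: "a < p" "b < p" "r < n" "s < n"
  shows "(kronecker (mat_adjoint (fourier_mat p)) (1\<^sub>m n) * diag_block_mat Ds *
            kronecker (fourier_mat p) (1\<^sub>m n)) $$ (a * n + r, b * n + s) =
         (\<Sum>c<p. dft_root p ^ (c * (b + (p - a))) * (Ds ! c) $$ (r, s)) / of_nat p"
proof -
  let ?F = "fourier_mat p" and ?G = "mat_adjoint (fourier_mat p)"
  let ?KF = "kronecker ?F (1\<^sub>m n)" and ?KG = "kronecker ?G (1\<^sub>m n)"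
  note c = kronecker_one_carrier[OF adjoint_carrier, of p n]
    kronecker_one_carrier[OF fourier_mat_carrier, of p n]
  have d: "diag_block_mat Ds \<in> carrier_mat (p * n) (p * n)"
    using diag_block_carrier[OF Ds(2)] Ds(1) by simp
  have 1: "(?KG * diag_block_mat Ds) $$ (a * n + r, e * n + t) = ?G $$ (a, e) * (Ds ! e) $$ (r, t)"
    if "e < p" "t < n" for e t
  proof -
    have "(?KG * diag_block_mat Ds) $$ (a * n + r, e * n + t) =
        (\<Sum>c<p. \<Sum>u<n. (if r = u then ?G $$ (a, c) else 0) *
           (if c = e then (Ds ! c) $$ (u, t) else 0))"
      using that abrs
      by (subst mult_index_blocks[OF c(1) d])
        (auto simp: block_index_less kronecker_one_index[OF adjoint_carrier]
          diag_block_index[OF Ds(2)] Ds(1) intro!: sum.cong)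
    also have "\<dots> = (\<Sum>c<p. \<Sum>u<n. if u = r then
                     (if c = e then ?G $$ (a, c) * (Ds ! c) $$ (r, t) else 0) else 0)"
      by (intro sum.cong refl) auto
    also have "\<dots> = ?G $$ (a, e) * (Ds ! e) $$ (r, t)"
      using that abrs by simp
    finally show ?thesis .
  qed
  have "(?KG * diag_block_mat Ds * ?KF) $$ (a * n + r, b * n + s) =
      (\<Sum>e<p. \<Sum>t<n. (?G $$ (a, e) * (Ds ! e) $$ (r, t)) * (if t = s then ?F $$ (e, b) else 0))"
    using abrs
    by (subst mult_index_blocks[OF mult_carrier_mat[OF c(1) d] c(2)])
      (auto simp: block_index_less 1 kronecker_one_index[OF fourier_mat_carrier] intro!: sum.cong)
  also have "\<dots> = (\<Sum>e<p. \<Sum>t<n. if t = s then ?G $$ (a, e) * (Ds ! e) $$ (r, s) * ?F $$ (e, b) else 0)"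
    by (intro sum.cong refl) auto
  also have "\<dots> = (\<Sum>e<p. ?G $$ (a, e) * (Ds ! e) $$ (r, s) * ?F $$ (e, b))"
    using abrs by simp
  also have "\<dots> = (\<Sum>e<p. dft_root p ^ (e * (b + (p - a))) * (Ds ! e) $$ (r, s) / of_nat p)"
  proof (intro sum.cong refl)
    fix e assume "e \<in> {..<p}"
    then have e: "e < p" by simp
    have sq: "complex_of_real (sqrt (real p)) * complex_of_real (sqrt (real p)) = of_nat p"
      by (simp flip: of_real_mult)
    have "cnj (dft_root p) ^ (e * a) = dft_root p ^ (e * (p - a))"
      using cnj_dft_root_power[of a p] abrs
      by (metis less_imp_le_nat less_nat_zero_code mult.commute not_gr_zero power_mult)
    then have "dft_root p ^ (e * (b + (p - a))) = dft_root p ^ (e * b) * cnj (dft_root p) ^ (e * a)"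
      by (simp only: add_mult_distrib2 power_add)
    then show "?G $$ (a, e) * (Ds ! e) $$ (r, s) * ?F $$ (e, b) =
               dft_root p ^ (e * (b + (p - a))) * (Ds ! e) $$ (r, s) / of_nat p"
      using e abrs
      by (simp add: adjoint_index fourier_mat_index mult_ac flip: sq)
  qed
  finally show ?thesis by (simp add: sum_divide_distrib)
qed

lemma bcirc_index:
  assumes "A \<in> carrier_tensor n n p" "a < p" "b < p" "r < n" "s < n"
  shows "bcirc A $$ (a * n + r, b * n + s) = (A ! ((a + (p - b)) mod p)) $$ (r, s)"
proof -
  have "int (a + (p - b)) = int a - int b + int p"
    using assms(3) by (simp add: of_nat_diff)
  then have "(int a - int b) mod int p = int (a + (p - b)) mod int p"
    by (simp only: mod_add_self2)
  then have "nat ((int a - int b) mod int p) = (a + (p - b)) mod p"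
    by (metis nat_int zmod_int)
  moreover have "a * n + r < n * p" "b * n + s < n * p"
    using block_index_less[of a p r n] block_index_less[of b p s n] assms
    by (simp_all add: mult.commute)
  ultimately show ?thesis
    using carrier_tensorD[OF assms(1)] assms(2-) by (simp add: bcirc_def Let_def)
qed

lemma is_fourier_blocks_iff:
  assumes A: "A \<in> carrier_tensor n n p" and n: "0 < n" and p: "0 < p"
    and Ds: "length Ds = p" "set Ds \<subseteq> carrier_mat n n"
  shows "is_fourier_blocks n p A Ds \<longleftrightarrow>
    (\<forall>d<p. \<forall>r<n. \<forall>s<n. (Ds ! d) $$ (r, s) = (\<Sum>j<p. dft_root p ^ (d * j) * (A ! j) $$ (r, s)))"
    (is "_ \<longleftrightarrow> ?R")
proof -
  let ?P = "kronecker (mat_adjoint (fourier_mat p)) (1\<^sub>m n) * diag_block_mat Ds *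
            kronecker (fourier_mat p) (1\<^sub>m n)"
  have cP: "?P \<in> carrier_mat (p * n) (p * n)"
    using kronecker_one_carrier[OF adjoint_carrier, of p n] diag_block_carrier[OF Ds(2)]
      kronecker_one_carrier[OF fourier_mat_carrier, of p n] Ds(1) by simp
  have cA: "bcirc A \<in> carrier_mat (p * n) (p * n)"
    using carrier_tensorD[OF A] p by (simp add: bcirc_def Let_def mult.commute)
  have orth: "(\<Sum>c<p. dft_root p ^ (c * x) * (\<Sum>j<p. dft_root p ^ (c * j) * f j)) =
      of_nat p * f ((p - x mod p) mod p)" for x and f :: "nat \<Rightarrow> complex"
  proof -
    have "(\<Sum>c<p. dft_root p ^ (c * x) * (\<Sum>j<p. dft_root p ^ (c * j) * f j)) =
        (\<Sum>c<p. \<Sum>j<p. dft_root p ^ (c * (x + j)) * f j)"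
      by (simp add: sum_distrib_left add_mult_distrib2 power_add mult_ac)
    also have "\<dots> = (\<Sum>j<p. (\<Sum>c<p. dft_root p ^ (c * (x + j))) * f j)"
      by (subst sum.swap) (simp add: sum_distrib_right)
    also have "\<dots> = (\<Sum>j<p. if j = (p - x mod p) mod p then of_nat p * f j else 0)"
    proof (intro sum.cong refl)
      fix j assume "j \<in> {..<p}"
      then have j: "j < p" by simp
      have y: "x mod p < p" using p by simp
      have "p dvd x + j \<longleftrightarrow> (x mod p + j) mod p = 0"
        by (simp add: dvd_eq_mod_eq_0 mod_simps)
      also have "\<dots> \<longleftrightarrow> j = (p - x mod p) mod p"
      proof (cases "x mod p = 0")
        case True
        then show ?thesis using j by simp
      next
        case False
        then have "(p - x mod p) mod p = p - x mod p" using p by simp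
        moreover have "(x mod p + j) mod p = 0 \<longleftrightarrow> x mod p + j = p"
        proof
          assume "(x mod p + j) mod p = 0"
          then obtain k where k: "x mod p + j = p * k" by (auto simp: mod_eq_0_iff_dvd dvd_def)
          have "0 < p * k" "p * k < p * 2" using k False y j by linarith+
          then have "k = 1" by auto
          then show "x mod p + j = p" using k by simp
        qed simp
        ultimately show ?thesis using y by auto
      qed
      finally show "(\<Sum>c<p. dft_root p ^ (c * (x + j))) * f j =
          (if j = (p - x mod p) mod p then of_nat p * f j else 0)"
        using dft_root_sum[OF p] by simp
    qed
    also have "\<dots> = of_nat p * f ((p - x mod p) mod p)" using p by simp
    finally show ?thesis .
  qed
  have "is_fourier_blocks n p A Ds \<longleftrightarrow> bcirc A = ?P"
    using Ds by (simp add: is_fourier_blocks_def)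
  also have "\<dots> \<longleftrightarrow> ?R"
  proof
    assume eq: "bcirc A = ?P"
    show ?R
    proof (intro allI impI)
      fix d r s assume d: "d < p" and r: "r < n" and s: "s < n"
      have Aj: "(A ! j) $$ (r, s) = (\<Sum>c<p. dft_root p ^ (c * (p - j)) * (Ds ! c) $$ (r, s)) / of_nat p"
        if j: "j < p" for j
        using bcirc_index[OF A j p r s] fourier_product_index[OF Ds j p r s] eq j by simp
      have "(\<Sum>j<p. dft_root p ^ (d * j) * (A ! j) $$ (r, s)) =
          (\<Sum>j<p. dft_root p ^ (d * j) *
             (\<Sum>c<p. dft_root p ^ (j * (p - c)) * (Ds ! c) $$ (r, s)) / of_nat p)"
      proof (intro sum.cong refl)
        fix j assume "j \<in> {..<p}"
        then have j: "j < p" by simp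
        have "dft_root p ^ (c * (p - j)) = dft_root p ^ (j * (p - c))" if "c < p" for c
          using cnj_dft_root_power[of j p] cnj_dft_root_power[of c p] that j p
          by (metis less_imp_le_nat mult.commute power_mult)
        then show "dft_root p ^ (d * j) * (A ! j) $$ (r, s) = dft_root p ^ (d * j) *
             (\<Sum>c<p. dft_root p ^ (j * (p - c)) * (Ds ! c) $$ (r, s)) / of_nat p"
          using Aj[OF j] by simp
      qed
      also have "\<dots> = (\<Sum>c<p. (\<Sum>j<p. dft_root p ^ (j * (d + (p - c)))) * (Ds ! c) $$ (r, s)) / of_nat p"
        unfolding sum_divide_distrib[symmetric] sum_distrib_left sum_distrib_right
        by (subst sum.swap) (simp only: add_mult_distrib2 power_add mult_ac)
      also have "\<dots> = (\<Sum>c<p. if c = d then of_nat p * (Ds ! c) $$ (r, s) else 0) / of_nat p"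
      proof -
        have "p dvd d + (p - c) \<longleftrightarrow> c = d" if c: "c < p" for c
        proof
          assume "p dvd d + (p - c)"
          then obtain k where k: "d + (p - c) = p * k" by (auto simp: dvd_def)
          have "0 < p * k" "p * k < p * 2" using k c d by linarith+
          then have "k = 1" by auto
          then show "c = d" using k c d by simp
        next
          assume "c = d"
          then show "p dvd d + (p - c)" using c by simp
        qed
        then show ?thesis
          by (intro arg_cong2[where f = "(/)"] sum.cong refl) (simp add: dft_root_sum[OF p])
      qed
      also have "\<dots> = (Ds ! d) $$ (r, s)" using d p by simp
      finally show "(Ds ! d) $$ (r, s) = (\<Sum>j<p. dft_root p ^ (d * j) * (A ! j) $$ (r, s))" ..
    qed
  next
    assume R: ?R
    show "bcirc A = ?P"
    proof (rule eq_matI_blocks[OF cA cP n])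
      fix a b r s assume h: "a < p" "b < p" "r < n" "s < n"
      have idx: "(p - (b + (p - a)) mod p) mod p = (a + (p - b)) mod p"
      proof (cases "b < a")
        case True
        then have "(b + (p - a)) mod p = b + (p - a)" using h by simp
        moreover have "p - (b + (p - a)) = a - b" using True h by simp
        moreover have "a + (p - b) = a - b + p" using True h by simp
        ultimately show ?thesis by (simp only: mod_add_self2)
      next
        case False
        then have "b + (p - a) = b - a + p" using h by simp
        then have "(b + (p - a)) mod p = (b - a) mod p" by (simp only: mod_add_self2)
        then have "(b + (p - a)) mod p = b - a" using h by simp
        moreover have "p - (b - a) = a + (p - b)" using False h by simp
        ultimately show ?thesis by simp
      qed
      have "?P $$ (a * n + r, b * n + s) =
          (\<Sum>c<p. dft_root p ^ (c * (b + (p - a))) *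
             (\<Sum>j<p. dft_root p ^ (c * j) * (A ! j) $$ (r, s))) / of_nat p"
        using R h by (subst fourier_product_index[OF Ds h]) simp
      also have "\<dots> = (A ! ((a + (p - b)) mod p)) $$ (r, s)"
        unfolding orth idx using p by simp
      finally show "bcirc A $$ (a * n + r, b * n + s) = ?P $$ (a * n + r, b * n + s)"
        using bcirc_index[OF A h] by simp
    qed
  qed
  finally show ?thesis .
qed

lemma ex1_fourier_blocks:
  assumes A: "A \<in> carrier_tensor n n p" and n: "0 < n" and p: "0 < p"
  shows "\<exists>!Ds. is_fourier_blocks n p A Ds"
proof
  let ?Ds = "map (\<lambda>d. mat n n (\<lambda>(r, s). \<Sum>j<p. dft_root p ^ (d * j) * (A ! j) $$ (r, s))) [0..<p]"
  have l: "length ?Ds = p" and c: "set ?Ds \<subseteq> carrier_mat n n" by auto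
  show "is_fourier_blocks n p A ?Ds"
    unfolding is_fourier_blocks_iff[OF A n p l c] by simp
  fix Ds assume D: "is_fourier_blocks n p A Ds"
  then have l': "length Ds = p" and c': "set Ds \<subseteq> carrier_mat n n"
    by (auto simp: is_fourier_blocks_def)
  show "Ds = ?Ds"
  proof (rule nth_equalityI)
    show "length Ds = length ?Ds" using l' by simp
    fix d assume "d < length Ds"
    then have d: "d < p" "Ds ! d \<in> carrier_mat n n" using l' c' by auto
    show "Ds ! d = ?Ds ! d"
      using D[unfolded is_fourier_blocks_iff[OF A n p l' c']] d by (intro eq_matI) auto
  qed
qed

lemma is_fourier_blocks_fourier_blocks:
  assumes A: "A \<in> carrier_tensor n n p" and n: "0 < n" and p: "0 < p"
  shows "is_fourier_blocks n p A (fourier_blocks A)"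
  unfolding fourier_blocks_def carrier_tensorD(1)[OF A] carrier_tensorD(3)[OF A p]
  using ex1_fourier_blocks[OF assms] by (rule theI')

end

theory Submission
  imports Defs
begin

text \<open>
  The discrete Fourier transform along the third index, which takes \<open>A\<close> to the matrices
  \<open>\<Sum>j<p. \<omega> ^ (d * j) * A\<^sub>j\<close> for \<open>d < p\<close>, turns the cyclic convolution hidden in the
  T-product into \<open>p\<close> independent matrix products (\<open>slice_dft_t_prod\<close>). It is thus an injective
  algebra homomorphism, and it sends \<open>A\<close> to its Fourier blocks \<open>D\<^sub>d\<close>. Consequently
  \<open>q(A)\<close> is sent to \<open>q(D\<^sub>d)\<close>, and \<open>q(A) = 0\<close> as soon as \<open>q\<close> annihilates every block.

  The least common multiple of the characteristic polynomials does so by the Cayley--Hamilton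
  theorem, which is proved here directly for all multiples of the characteristic
  polynomial (\<open>cayley_hamilton_dvd\<close>). Sums of matrices and tensors are written entry by entry.
\<close>

section \<open>The Cayley--Hamilton theorem\<close>

lemma char_poly_matrix_mult_index:
  fixes M :: "'a :: comm_ring_1 mat" and C :: "'a poly mat"
  assumes M: "M \<in> carrier_mat n n" and C: "C \<in> carrier_mat n n" and r: "r < n" and s: "s < n"
  shows "(char_poly_matrix M * C) $$ (r, s) =
    pCons 0 (C $$ (r, s)) - (\<Sum>t<n. Polynomial.smult (M $$ (r, t)) (C $$ (t, s)))"
proof -
  have "(char_poly_matrix M * C) $$ (r, s) =
      (\<Sum>t\<in>{0..<n}. char_poly_matrix M $$ (r, t) * C $$ (t, s))"
    using carrier_matD[OF char_poly_matrix_closed[OF M]] C r s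
    by (auto simp: scalar_prod_def intro!: sum.cong)
  also have "\<dots> = (\<Sum>t<n. (if t = r then pCons 0 (C $$ (r, s)) else 0) -
      Polynomial.smult (M $$ (r, t)) (C $$ (t, s)))"
    using M r by (auto simp: char_poly_matrix_def atLeast0LessThan intro!: sum.cong)
  finally show ?thesis using r by (simp add: sum_subtractf)
qed

text \<open>
  Write \<open>q = c \<cdot> det (x I - M)\<close> and put \<open>Q = c \<cdot> adj (x I - M)\<close>, so that \<open>(x I - M) Q = q I\<close>. Comparing coefficients of
  \<open>x ^ k\<close> gives \<open>q\<^sub>k I = Q\<^sub>k\<^sub>-\<^sub>1 - M Q\<^sub>k\<close>. After multiplication by \<open>M ^ k\<close> from the left the
  sum over \<open>k \<le> N\<close> telescopes to \<open>- M ^ (N + 1) Q\<^sub>N\<close>, which vanishes once \<open>N\<close> exceeds the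
  degrees of all entries of \<open>Q\<close>.
\<close>

lemma cayley_hamilton_dvd:
  fixes M :: "'a :: comm_ring_1 mat"
  assumes M: "M \<in> carrier_mat n n" and dvd: "char_poly M dvd q" and r: "r < n" and s: "s < n"
  shows "(\<Sum>k\<le>degree q. coeff q k * (M ^\<^sub>m k) $$ (r, s)) = 0"
proof -
  obtain c where c: "q = char_poly M * c" using dvd by (elim dvdE)
  define Q where "Q = c \<cdot>\<^sub>m adj_mat (char_poly_matrix M)"
  define b where "b k = mat n n (\<lambda>(i, j). coeff (Q $$ (i, j)) k)" for k
  note X = char_poly_matrix_closed[OF M]
  have Q: "Q \<in> carrier_mat n n" using adj_mat(1)[OF X] by (simp add: Q_def)
  have b: "b k \<in> carrier_mat n n" for k by (simp add: b_def)
  have pow: "M ^\<^sub>m k \<in> carrier_mat n n" for k using M by (simp add: pow_carrier_mat)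
  have "char_poly_matrix M * Q = q \<cdot>\<^sub>m 1\<^sub>m n"
    using adj_mat[OF X] X
    by (auto simp: Q_def c char_poly_def mult_smult_distrib ac_simps intro!: eq_matI)
  then have coeffs: "(if i = j then coeff q k else 0) =
      coeff (pCons 0 (Q $$ (i, j))) k - (M * b k) $$ (i, j)" if "i < n" "j < n" for i j k
    using char_poly_matrix_mult_index[OF M Q that, symmetric] that M
    by (auto simp: b_def scalar_prod_def atLeast0LessThan coeff_sum dest!: arg_cong[where f = "\<lambda>f. coeff f k"])
  have c0: "coeff q 0 \<cdot>\<^sub>m 1\<^sub>m n = - (M * b 0)"
  proof (rule eq_matI)
    fix i j assume "i < dim_row (- (M * b 0))" "j < dim_col (- (M * b 0))"
    then have "i < n" "j < n" using M b[of 0] by auto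
    with coeffs[OF this, of 0] show "(coeff q 0 \<cdot>\<^sub>m 1\<^sub>m n) $$ (i, j) = (- (M * b 0)) $$ (i, j)"
      using M b[of 0] by (auto split: if_splits)
  qed (use M b[of 0] in auto)
  have cSuc: "coeff q (Suc k) \<cdot>\<^sub>m 1\<^sub>m n = b k - M * b (Suc k)" for k
  proof (rule eq_matI)
    fix i j assume "i < dim_row (b k - M * b (Suc k))" "j < dim_col (b k - M * b (Suc k))"
    then have "i < n" "j < n" using M b[of "Suc k"] by auto
    with coeffs[OF this, of "Suc k"]
    show "(coeff q (Suc k) \<cdot>\<^sub>m 1\<^sub>m n) $$ (i, j) = (b k - M * b (Suc k)) $$ (i, j)"
      using M b[of "Suc k"] by (auto simp: b_def[of k] split: if_splits)
  qed (use M b[of "Suc k"] in auto)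
  have telescope: "(\<Sum>k\<le>N. coeff q k * (M ^\<^sub>m k) $$ (r, s)) = - (M ^\<^sub>m Suc N * b N) $$ (r, s)" for N
  proof (induction N)
    case 0
    have "coeff q 0 * (M ^\<^sub>m 0) $$ (r, s) = (coeff q 0 \<cdot>\<^sub>m 1\<^sub>m n) $$ (r, s)"
      using r s M by simp
    then show ?case unfolding c0 using r s M b[of 0] by simp
  next
    case (Suc N)
    let ?P = "M ^\<^sub>m Suc N"
    have "coeff q (Suc N) \<cdot>\<^sub>m ?P = ?P * (coeff q (Suc N) \<cdot>\<^sub>m 1\<^sub>m n)"
      using mult_smult_distrib[OF pow one_carrier_mat] right_mult_one_mat[OF pow]
      by (simp del: pow_mat.simps)
    also have "\<dots> = ?P * b N - ?P * (M * b (Suc N))"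
      unfolding cSuc by (rule mult_minus_distrib_mat[OF pow b mult_carrier_mat[OF M b]])
    also have "?P * (M * b (Suc N)) = M ^\<^sub>m Suc (Suc N) * b (Suc N)"
      by (simp only: pow_mat.simps(2)[of M "Suc N"] assoc_mult_mat[OF pow M b])
    finally have "(coeff q (Suc N) \<cdot>\<^sub>m ?P) $$ (r, s) =
      (?P * b N - M ^\<^sub>m Suc (Suc N) * b (Suc N)) $$ (r, s)" by simp
    then have "coeff q (Suc N) * ?P $$ (r, s) =
      (?P * b N) $$ (r, s) - (M ^\<^sub>m Suc (Suc N) * b (Suc N)) $$ (r, s)"
      using r s by (simp add: carrier_matD[OF M] carrier_matD[OF b] del: pow_mat.simps index_mult_mat(1))
    then show ?case using Suc.IH by (simp del: pow_mat.simps)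
  qed
  \<comment> \<open>The double sum is a convenient bound for the degrees of all entries at once.\<close>
  define N where "N = degree q + (\<Sum>i<n. \<Sum>j<n. Suc (degree (Q $$ (i, j))))"
  have "coeff (Q $$ (i, j)) N = 0" if "i < n" "j < n" for i j
  proof (rule coeff_eq_0)
    have "Suc (degree (Q $$ (i, j))) \<le> (\<Sum>j<n. Suc (degree (Q $$ (i, j))))"
      using that member_le_sum[of j "{..<n}" "\<lambda>j. Suc (degree (Q $$ (i, j)))"] by simp
    also have "\<dots> \<le> (\<Sum>i<n. \<Sum>j<n. Suc (degree (Q $$ (i, j))))"
      using that member_le_sum[of i "{..<n}" "\<lambda>i. \<Sum>j<n. Suc (degree (Q $$ (i, j)))"] by simp
    finally show "degree (Q $$ (i, j)) < N" by (simp add: N_def)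
  qed
  then have "b N = 0\<^sub>m n n" by (auto simp: b_def)
  then have "(\<Sum>k\<le>N. coeff q k * (M ^\<^sub>m k) $$ (r, s)) = 0"
    using telescope[of N] right_mult_zero_mat[OF pow, of "Suc N" n] r s by (simp del: pow_mat.simps)
  moreover have "(\<Sum>k\<le>degree q. coeff q k * (M ^\<^sub>m k) $$ (r, s)) =
      (\<Sum>k\<le>N. coeff q k * (M ^\<^sub>m k) $$ (r, s))"
    by (rule sum.mono_neutral_left) (auto simp: N_def coeff_eq_0)
  ultimately show ?thesis by simp
qed

section \<open>Tensor operations entry by entry\<close>

lemma tensor_eqI:
  assumes "A \<in> carrier_tensor m n p" "B \<in> carrier_tensor m n p"
    and "\<And>a r s. a < p \<Longrightarrow> r < m \<Longrightarrow> s < n \<Longrightarrow> (A ! a) $$ (r, s) = (B ! a) $$ (r, s)"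
  shows "A = B"
proof (rule nth_equalityI)
  show "length A = length B" using assms(1,2) by (simp add: carrier_tensor_def)
  fix a assume "a < length A"
  then have "a < p" using assms(1) by (simp add: carrier_tensor_def)
  with carrier_tensorD(2)[OF assms(1) this] carrier_tensorD(2)[OF assms(2) this] assms(3)
  show "A ! a = B ! a" by (intro eq_matI) auto
qed

lemma zero_tensor_carrier: "zero_tensor m n p \<in> carrier_tensor m n p"
  by (auto simp: zero_tensor_def carrier_tensor_def)

lemma zero_tensor_index:
  "a < p \<Longrightarrow> r < m \<Longrightarrow> s < n \<Longrightarrow> (zero_tensor m n p ! a) $$ (r, s) = 0"
  by (simp add: zero_tensor_def)

lemma id_tensor_carrier: "id_tensor n p \<in> carrier_tensor n n p"
  by (auto simp: id_tensor_def carrier_tensor_def)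

lemma smult_tensor_carrier:
  "A \<in> carrier_tensor m n p \<Longrightarrow> smult_tensor c A \<in> carrier_tensor m n p"
  by (auto simp: smult_tensor_def carrier_tensor_def)

lemma smult_tensor_index:
  assumes "A \<in> carrier_tensor m n p" "a < p" "r < m" "s < n"
  shows "(smult_tensor c A ! a) $$ (r, s) = c * (A ! a) $$ (r, s)"
  using carrier_tensorD(1)[OF assms(1)] carrier_matD[OF carrier_tensorD(2)[OF assms(1,2)]] assms(2-)
  by (simp add: smult_tensor_def)

lemma add_tensor_carrier:
  assumes "A \<in> carrier_tensor m n p" "B \<in> carrier_tensor m n p"
  shows "add_tensor A B \<in> carrier_tensor m n p"
  using carrier_tensorD(1,2)[OF assms(1)] carrier_tensorD(1,2)[OF assms(2)]
  by (auto simp: add_tensor_def carrier_tensor_def in_set_conv_nth)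

lemma add_tensor_index:
  assumes "A \<in> carrier_tensor m n p" "B \<in> carrier_tensor m n p" "a < p" "r < m" "s < n"
  shows "(add_tensor A B ! a) $$ (r, s) = (A ! a) $$ (r, s) + (B ! a) $$ (r, s)"
  using carrier_tensorD(1)[OF assms(1)] carrier_tensorD(1)[OF assms(2)]
    carrier_matD[OF carrier_tensorD(2)[OF assms(2,3)]] assms(3-)
  by (simp add: add_tensor_def)

lemma foldr_add_tensor:
  assumes "set Xs \<subseteq> carrier_tensor m n p"
  shows "foldr add_tensor Xs (zero_tensor m n p) \<in> carrier_tensor m n p"
    and "a < p \<Longrightarrow> r < m \<Longrightarrow> s < n \<Longrightarrow>
      (foldr add_tensor Xs (zero_tensor m n p) ! a) $$ (r, s) = (\<Sum>X\<leftarrow>Xs. (X ! a) $$ (r, s))"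
proof -
  have "foldr add_tensor Xs (zero_tensor m n p) \<in> carrier_tensor m n p \<and>
    (a < p \<longrightarrow> r < m \<longrightarrow> s < n \<longrightarrow>
      (foldr add_tensor Xs (zero_tensor m n p) ! a) $$ (r, s) = (\<Sum>X\<leftarrow>Xs. (X ! a) $$ (r, s)))"
    using assms
    by (induction Xs)
      (auto simp: zero_tensor_carrier add_tensor_carrier add_tensor_index zero_tensor_index)
  then show "foldr add_tensor Xs (zero_tensor m n p) \<in> carrier_tensor m n p"
    and "a < p \<Longrightarrow> r < m \<Longrightarrow> s < n \<Longrightarrow>
      (foldr add_tensor Xs (zero_tensor m n p) ! a) $$ (r, s) = (\<Sum>X\<leftarrow>Xs. (X ! a) $$ (r, s))"
    by blast+
qed

lemma t_prod_carrier:
  assumes "A \<in> carrier_tensor n n p" "B \<in> carrier_tensor n n p" "0 < p"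
  shows "t_prod A B \<in> carrier_tensor n n p"
  using carrier_tensorD[OF assms(1)] carrier_tensorD[OF assms(2)] assms(3)
  by (auto simp: t_prod_def fold_tensor_def bcirc_def unfold_tensor_def Let_def carrier_tensor_def)

lemma t_prod_index:
  assumes A: "A \<in> carrier_tensor n n p" and B: "B \<in> carrier_tensor n n p"
    and a: "a < p" and r: "r < n" and s: "s < n"
  shows "(t_prod A B ! a) $$ (r, s) =
    (\<Sum>b<p. \<Sum>t<n. (A ! ((a + (p - b)) mod p)) $$ (r, t) * (B ! b) $$ (t, s))"
proof -
  have p: "0 < p" using a by simp
  note DA = carrier_tensorD[OF A] and DB = carrier_tensorD[OF B]
  have cA: "bcirc A \<in> carrier_mat (n * p) (n * p)"
    using DA p by (simp add: bcirc_def Let_def)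
  have cB: "unfold_tensor B \<in> carrier_mat (n * p) n"
    using DB p by (simp add: unfold_tensor_def Let_def)
  have row: "a * n + r < n * p"
    using block_index_less[OF a r] by (simp add: mult.commute)
  have uB: "unfold_tensor B $$ (b * n + t, s) = (B ! b) $$ (t, s)" if "b < p" "t < n" for b t
    using block_index_less[OF that] DB p s that
    by (simp add: unfold_tensor_def Let_def mult.commute)
  have "(t_prod A B ! a) $$ (r, s) = (bcirc A * unfold_tensor B) $$ (a * n + r, s)"
    using cA cB a r s DA p by (simp add: t_prod_def fold_tensor_def Let_def)
  also have "\<dots> = (\<Sum>k\<in>{0..<p * n}. bcirc A $$ (a * n + r, k) * unfold_tensor B $$ (k, s))"
    using cA cB row s by (auto simp: scalar_prod_def mult.commute intro!: sum.cong)
  also have "\<dots> = (\<Sum>b<p. \<Sum>t<n. bcirc A $$ (a * n + r, b * n + t) * unfold_tensor B $$ (b * n + t, s))"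
    by (rule sum_blocks)
  also have "\<dots> = (\<Sum>b<p. \<Sum>t<n. (A ! ((a + (p - b)) mod p)) $$ (r, t) * (B ! b) $$ (t, s))"
    using bcirc_index[OF A a _ r] uB by (intro sum.cong refl) simp
  finally show ?thesis .
qed

lemma t_pow_carrier:
  assumes A: "A \<in> carrier_tensor n n p" and p: "0 < p"
  shows "t_pow A k \<in> carrier_tensor n n p"
proof (induction k)
  case 0
  then show ?case using carrier_tensorD[OF A] p by (simp add: id_tensor_carrier)
qed (simp add: t_prod_carrier[OF _ A p])

lemma t_poly_carrier:
  assumes A: "A \<in> carrier_tensor n n p" and p: "0 < p"
  shows "t_poly q A \<in> carrier_tensor n n p"
proof -
  let ?Xs = "map (\<lambda>k. smult_tensor (coeff q k) (t_pow A k)) [0..<Suc (degree q)]"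
  have "set ?Xs \<subseteq> carrier_tensor n n p"
    by (auto simp del: upt_Suc intro!: smult_tensor_carrier t_pow_carrier[OF A p])
  from foldr_add_tensor(1)[OF this] show ?thesis
    using carrier_tensorD[OF A] p by (simp add: t_poly_def del: upt_Suc)
qed

lemma t_poly_index:
  assumes A: "A \<in> carrier_tensor n n p" and p: "a < p" and r: "r < n" and s: "s < n"
  shows "(t_poly q A ! a) $$ (r, s) = (\<Sum>k\<le>degree q. coeff q k * (t_pow A k ! a) $$ (r, s))"
proof -
  have p0: "0 < p" using p by simp
  let ?Xs = "map (\<lambda>k. smult_tensor (coeff q k) (t_pow A k)) [0..<Suc (degree q)]"
  have "set ?Xs \<subseteq> carrier_tensor n n p"
    by (auto simp del: upt_Suc intro!: smult_tensor_carrier t_pow_carrier[OF A p0])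
  from foldr_add_tensor(2)[OF this p r s] have
    "(t_poly q A ! a) $$ (r, s) =
      (\<Sum>k\<leftarrow>[0..<Suc (degree q)]. coeff q k * (t_pow A k ! a) $$ (r, s))"
    using carrier_tensorD[OF A] p0 
    by (simp add: t_poly_def o_def smult_tensor_index[OF t_pow_carrier[OF A p0] p r s] del: upt_Suc)
  also have "\<dots> = (\<Sum>k\<le>degree q. coeff q k * (t_pow A k ! a) $$ (r, s))"
    by (simp only: interv_sum_list_conv_sum_set_nat set_upt atLeast0LessThan lessThan_Suc_atMost)
  finally show ?thesis .
qed

section \<open>The Fourier transform along the third index\<close>

definition slice_dft :: "tensor \<Rightarrow> nat \<Rightarrow> complex mat" where
  "slice_dft A d = mat (slice_rows A) (slice_cols A)
     (\<lambda>(r, s). \<Sum>j<length A. dft_root (length A) ^ (d * j) * (A ! j) $$ (r, s))"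

lemma slice_dft_carrier:
  "A \<in> carrier_tensor m n p \<Longrightarrow> 0 < p \<Longrightarrow> slice_dft A d \<in> carrier_mat m n"
  using carrier_tensorD(3,4)[of A m n p] by (simp add: slice_dft_def)

lemma slice_dft_index:
  assumes "A \<in> carrier_tensor m n p" "0 < p" "r < m" "s < n"
  shows "slice_dft A d $$ (r, s) = (\<Sum>j<p. dft_root p ^ (d * j) * (A ! j) $$ (r, s))"
  using carrier_tensorD(1,3,4)[OF assms(1)] assms(2-) by (simp add: slice_dft_def)

text \<open>
  Summing over the Fourier index against \<open>\<omega> ^ (d * (p - i))\<close> recovers slice \<open>i\<close>, by
  orthogonality of the characters \<open>d \<mapsto> \<omega> ^ (d * k)\<close> of \<open>\<int> / p\<close>.
\<close>

lemma slice_dft_inversion: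
  assumes A: "A \<in> carrier_tensor m n p" and i: "i < p" and r: "r < m" and s: "s < n"
  shows "(\<Sum>d<p. dft_root p ^ (d * (p - i)) * slice_dft A d $$ (r, s)) = of_nat p * (A ! i) $$ (r, s)"
proof -
  have p: "0 < p" using i by simp
  have dvd: "p dvd p - i + j \<longleftrightarrow> j = i" if "j < p" for j
  proof
    assume "p dvd p - i + j"
    then obtain k where k: "p - i + j = p * k" by (auto simp: dvd_def)
    have "0 < p * k" "p * k < p * 2" using k that i by linarith+
    then have "k = 1" by auto
    then show "j = i" using k that i by simp
  qed (use i in simp)
  have "(\<Sum>d<p. dft_root p ^ (d * (p - i)) * slice_dft A d $$ (r, s)) =
      (\<Sum>d<p. \<Sum>j<p. dft_root p ^ (d * (p - i + j)) * (A ! j) $$ (r, s))"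
    by (simp add: slice_dft_index[OF A p r s] sum_distrib_left distrib_left power_add mult.assoc)
  also have "\<dots> = (\<Sum>j<p. (\<Sum>d<p. dft_root p ^ (d * (p - i + j))) * (A ! j) $$ (r, s))"
    by (subst sum.swap) (simp add: sum_distrib_right)
  also have "\<dots> = (\<Sum>j<p. if j = i then of_nat p * (A ! j) $$ (r, s) else 0)"
    by (intro sum.cong refl) (simp add: dft_root_sum[OF p] dvd)
  finally show ?thesis using i by simp
qed

lemma zero_tensor_if_slice_dft_zero:
  assumes A: "A \<in> carrier_tensor m n p" and zero: "\<And>d. d < p \<Longrightarrow> slice_dft A d = 0\<^sub>m m n"
  shows "A = zero_tensor m n p"
proof (rule tensor_eqI[OF A zero_tensor_carrier])
  fix i r s assume h: "i < p" "r < m" "s < n"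
  have "of_nat p * (A ! i) $$ (r, s) = 0"
    using slice_dft_inversion[OF A h] zero h by simp
  then show "(A ! i) $$ (r, s) = (zero_tensor m n p ! i) $$ (r, s)"
    using h by (simp add: zero_tensor_index)
qed

lemma slice_dft_id_tensor:
  assumes "0 < p"
  shows "slice_dft (id_tensor n p) d = 1\<^sub>m n"
proof (rule eq_matI)
  fix r s assume "r < dim_row (1\<^sub>m n :: complex mat)" "s < dim_col (1\<^sub>m n :: complex mat)"
  then have rs: "r < n" "s < n" by simp_all
  have "slice_dft (id_tensor n p) d $$ (r, s) =
      (\<Sum>j<p. dft_root p ^ (d * j) * (id_tensor n p ! j) $$ (r, s))"
    by (rule slice_dft_index[OF id_tensor_carrier assms rs])
  also have "\<dots> = (\<Sum>j<p. if j = 0 then (1\<^sub>m n :: complex mat) $$ (r, s) else 0)"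
    using rs by (intro sum.cong refl) (simp add: id_tensor_def)
  finally show "slice_dft (id_tensor n p) d $$ (r, s) = (1\<^sub>m n :: complex mat) $$ (r, s)"
    using assms by simp
qed (use slice_dft_carrier[OF id_tensor_carrier assms] in auto)

text \<open>
  The shift theorem of the Fourier transform: \<open>dft_root p\<close> has order dividing \<open>p\<close>, so the exponent
  may be reduced modulo \<open>p\<close> when \<open>a\<close> is replaced by \<open>j + b\<close> in \<open>\<int> / p\<close>.
\<close>

lemma dft_shift:
  fixes f :: "nat \<Rightarrow> complex"
  assumes b: "b < p"
  shows "(\<Sum>a<p. dft_root p ^ (d * a) * f ((a + (p - b)) mod p)) =
    dft_root p ^ (d * b) * (\<Sum>j<p. dft_root p ^ (d * j) * f j)"
proof -
  have p: "0 < p" using b by simp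
  have unshift_shift: "((j + b) mod p + (p - b)) mod p = j" if "j < p" for j
  proof -
    have "((j + b) mod p + (p - b)) mod p = (j + b + (p - b)) mod p" by (rule mod_add_left_eq)
    also have "j + b + (p - b) = j + p" using b by simp
    finally show ?thesis using that by simp
  qed
  have shift_unshift: "((a + (p - b)) mod p + b) mod p = a" if "a < p" for a
  proof -
    have "((a + (p - b)) mod p + b) mod p = (a + (p - b) + b) mod p" by (rule mod_add_left_eq)
    also have "a + (p - b) + b = a + p" using b by simp
    finally show ?thesis using that by simp
  qed
  have root: "dft_root p ^ (d * ((j + b) mod p)) = dft_root p ^ (d * b) * dft_root p ^ (d * j)" for j
  proof -
    have "dft_root p ^ (d * ((j + b) mod p)) = (dft_root p ^ ((j + b) mod p)) ^ d"
      by (metis mult.commute power_mult)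
    also have "\<dots> = dft_root p ^ (d * (j + b))"
      unfolding dft_root_mod[OF p] by (metis mult.commute power_mult)
    finally show ?thesis by (simp add: distrib_left power_add mult.commute)
  qed
  have "(\<Sum>a<p. dft_root p ^ (d * a) * f ((a + (p - b)) mod p)) =
      (\<Sum>j<p. dft_root p ^ (d * ((j + b) mod p)) * f j)"
    by (rule sum.reindex_bij_witness[where i = "\<lambda>j. (j + b) mod p"
          and j = "\<lambda>a. (a + (p - b)) mod p"]) (use p in \<open>auto simp: unshift_shift shift_unshift\<close>)
  then show ?thesis by (simp add: root sum_distrib_left mult.assoc)
qed

text \<open>
  The slices of the T-product are the cyclic convolution of the slices of the factors, so this is
  the convolution theorem with matrix coefficients.
\<close>

lemma slice_dft_t_prod:
  assumes A: "A \<in> carrier_tensor n n p" and B: "B \<in> carrier_tensor n n p" and p: "0 < p"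
  shows "slice_dft (t_prod A B) d = slice_dft A d * slice_dft B d"
proof (rule eq_matI)
  note cAB = t_prod_carrier[OF A B p]
  note cA = slice_dft_carrier[OF A p] and cB = slice_dft_carrier[OF B p]
  let ?w = "dft_root p"
  fix r s assume "r < dim_row (slice_dft A d * slice_dft B d)"
    "s < dim_col (slice_dft A d * slice_dft B d)"
  then have r: "r < n" and s: "s < n" using cA[of d] cB[of d] by auto
  have "slice_dft (t_prod A B) d $$ (r, s) =
      (\<Sum>a<p. \<Sum>b<p. \<Sum>t<n. ?w ^ (d * a) * (A ! ((a + (p - b)) mod p)) $$ (r, t) * (B ! b) $$ (t, s))"
    by (simp add: slice_dft_index[OF cAB p r s] t_prod_index[OF A B _ r s] sum_distrib_left mult.assoc)
  also have "\<dots> = (\<Sum>b<p. \<Sum>a<p. \<Sum>t<n.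
      ?w ^ (d * a) * (A ! ((a + (p - b)) mod p)) $$ (r, t) * (B ! b) $$ (t, s))"
    by (rule sum.swap)
  also have "\<dots> = (\<Sum>b<p. \<Sum>t<n. (\<Sum>a<p. ?w ^ (d * a) * (A ! ((a + (p - b)) mod p)) $$ (r, t)) *
      (B ! b) $$ (t, s))"
    unfolding sum_distrib_right by (intro sum.cong refl sum.swap)
  also have "\<dots> = (\<Sum>b<p. \<Sum>t<n. slice_dft A d $$ (r, t) * (?w ^ (d * b) * (B ! b) $$ (t, s)))"
    using dft_shift[of _ p d "\<lambda>j. (A ! j) $$ (r, _)"]
    by (intro sum.cong refl) (simp add: slice_dft_index[OF A p r] mult_ac)
  also have "\<dots> = (\<Sum>t<n. slice_dft A d $$ (r, t) * slice_dft B d $$ (t, s))"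
    by (subst sum.swap) (simp add: slice_dft_index[OF B p _ s] sum_distrib_left)
  also have "\<dots> = (slice_dft A d * slice_dft B d) $$ (r, s)"
    using cA[of d] cB[of d] r s by (simp add: scalar_prod_def atLeast0LessThan)
  finally show "slice_dft (t_prod A B) d $$ (r, s) = (slice_dft A d * slice_dft B d) $$ (r, s)" .
qed (use slice_dft_carrier[OF A p, of d] slice_dft_carrier[OF B p, of d]
    slice_dft_carrier[OF t_prod_carrier[OF A B p] p, of d] in auto)

lemma slice_dft_t_pow:
  assumes A: "A \<in> carrier_tensor n n p" and p: "0 < p"
  shows "slice_dft (t_pow A k) d = slice_dft A d ^\<^sub>m k"
proof (induction k)
  case 0
  then show ?case
    using carrier_tensorD[OF A] p slice_dft_carrier[OF A p, of d] by (simp add: slice_dft_id_tensor)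
qed (simp add: slice_dft_t_prod[OF t_pow_carrier[OF A p] A p])

lemma slice_dft_t_poly_index:
  assumes A: "A \<in> carrier_tensor n n p" and p: "0 < p" and r: "r < n" and s: "s < n"
  shows "slice_dft (t_poly q A) d $$ (r, s) =
    (\<Sum>k\<le>degree q. coeff q k * (slice_dft A d ^\<^sub>m k) $$ (r, s))"
proof -
  have "slice_dft (t_poly q A) d $$ (r, s) =
      (\<Sum>j<p. \<Sum>k\<le>degree q. coeff q k * (dft_root p ^ (d * j) * (t_pow A k ! j) $$ (r, s)))"
    by (simp add: slice_dft_index[OF t_poly_carrier[OF A p] p r s] t_poly_index[OF A _ r s]
        sum_distrib_left mult_ac)
  also have "\<dots> = (\<Sum>k\<le>degree q. coeff q k * slice_dft (t_pow A k) d $$ (r, s))"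
    by (subst sum.swap) (simp add: slice_dft_index[OF t_pow_carrier[OF A p] p r s] sum_distrib_left)
  finally show ?thesis by (simp add: slice_dft_t_pow[OF A p])
qed

lemma fourier_blocks_eq_slice_dft:
  assumes A: "A \<in> carrier_tensor n n p" and n: "0 < n" and p: "0 < p"
  shows "fourier_blocks A = map (slice_dft A) [0..<p]"
proof -
  have l: "length (map (slice_dft A) [0..<p]) = p" by simp
  have c: "set (map (slice_dft A) [0..<p]) \<subseteq> carrier_mat n n"
    using slice_dft_carrier[OF A p] by auto
  have "is_fourier_blocks n p A (map (slice_dft A) [0..<p])"
    unfolding is_fourier_blocks_iff[OF A n p l c] by (simp add: slice_dft_index[OF A p])
  with ex1_fourier_blocks[OF A n p] is_fourier_blocks_fourier_blocks[OF A n p]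
  show ?thesis by blast
qed

section \<open>A tensor annihilates its T-characteristic polynomial\<close>

theorem theorem6:
  fixes n p :: nat and A :: tensor
  assumes "0 < n" and "0 < p"
    and "A \<in> carrier_tensor n n p"
  shows "t_poly (t_char_poly A) A = zero_tensor n n p"
proof (rule zero_tensor_if_slice_dft_zero)
  note n = assms(1) and p = assms(2) and A = assms(3)
  show c: "t_poly (t_char_poly A) A \<in> carrier_tensor n n p"
    by (rule t_poly_carrier[OF A p])
  fix d assume "d < p"
  then have dvd: "char_poly (slice_dft A d) dvd t_char_poly A"
    unfolding t_char_poly_def fourier_blocks_eq_slice_dft[OF A n p] by (intro dvd_Lcm) auto
  have "slice_dft (t_poly (t_char_poly A) A) d $$ (r, s) = 0" if "r < n" "s < n" for r s
    using slice_dft_t_poly_index[OF A p that]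
      cayley_hamilton_dvd[OF slice_dft_carrier[OF A p] dvd that] by simp
  then show "slice_dft (t_poly (t_char_poly A) A) d = 0\<^sub>m n n"
    using slice_dft_carrier[OF c p, of d] by (intro eq_matI) auto
qed

end
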